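(* Let $R$ be a unital ring and let $S$ be a multiplicative subset of $R$ such that (A) for every $s\in S$, the left ideal $Rs$ of $R$ is essential, and (B) for all essential left ideals $L$ of $R$, $S\cap L\neq\emptyset$. Then $S$ is a left Ore set of $R$.
   Context: A subset $S$ of $R$ is multiplicative if $1\in S$, $SS\subseteq S$ and $0\notin S$. A multiplicative set $S$ is a left Ore set if $Sr\cap Rs\neq\emptyset$ for all $r\in R$ and $s\in S$. A left ideal is essential if it meets every nonzero left ideal of $R$ nontrivially. *)

theory Defs
  imports "HOL-Algebra.Ideal"
begin

text \<open>
  Rings are the unital, not necessarily commutative rings of HOL-Algebra (locale \<open>ring\<close>).
  The left ideal $Rs$ is written \<open>carrier R #>\<^bsub>R\<^esub> s\<close>, the set of products
  $xs$ with $x$ in $R$, and likewise $Sr$ is \<open>S #>\<^bsub>R\<^esub> r\<close>.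
\<close>

text \<open>HOL-Algebra only has two-sided ideals; this is its \<open>ideal\<close> without right absorption.\<close>

locale left_ideal = additive_subgroup I R + ring R for I and R (structure) +
  assumes I_l_closed: "\<lbrakk>a \<in> I; x \<in> carrier R\<rbrakk> \<Longrightarrow> x \<otimes> a \<in> I"

definition essential_left_ideal :: "'a set \<Rightarrow> ('a, 'b) ring_scheme \<Rightarrow> bool"
  where "essential_left_ideal L R \<longleftrightarrow>
    left_ideal L R \<and> (\<forall>J. left_ideal J R \<longrightarrow> J \<noteq> {\<zero>\<^bsub>R\<^esub>} \<longrightarrow> L \<inter> J \<noteq> {\<zero>\<^bsub>R\<^esub>})"

definition multiplicative_subset :: "'a set \<Rightarrow> ('a, 'b) ring_scheme \<Rightarrow> bool"
  where "multiplicative_subset S R \<longleftrightarrow>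
    S \<subseteq> carrier R \<and> \<one>\<^bsub>R\<^esub> \<in> S \<and> S <#>\<^bsub>R\<^esub> S \<subseteq> S \<and> \<zero>\<^bsub>R\<^esub> \<notin> S"

definition left_Ore_set :: "'a set \<Rightarrow> ('a, 'b) ring_scheme \<Rightarrow> bool"
  where "left_Ore_set S R \<longleftrightarrow>
    multiplicative_subset S R \<and>
    (\<forall>r\<in>carrier R. \<forall>s\<in>S. (S #>\<^bsub>R\<^esub> r) \<inter> (carrier R #>\<^bsub>R\<^esub> s) \<noteq> {})"

end

theory Submission
  imports Defs
begin

text \<open>Fix \<open>r\<close> in \<open>R\<close> and \<open>s\<close> in \<open>S\<close>. An
  element \<open>t\<close> of \<open>S\<close> with \<open>t \<otimes> r\<close> in
  \<open>Rs\<close> is exactly an element of \<open>S\<close> in the colon left ideal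
  \<open>(Rs : r)\<close>, the set of all \<open>x\<close> with \<open>xr\<close> in
  \<open>Rs\<close>. By (A) \<open>Rs\<close> is essential; essentiality passes to colon ideals
  (\<open>essential_left_ideal_colon\<close>), so (B) supplies such a \<open>t\<close>, and
  \<open>tr\<close> is the required common element of \<open>Sr\<close> and
  \<open>Rs\<close>.\<close>

lemma (in ring) left_idealI:
  assumes "I \<subseteq> carrier R" and "\<zero> \<in> I"
    and add: "\<And>a b. a \<in> I \<Longrightarrow> b \<in> I \<Longrightarrow> a \<oplus> b \<in> I"
    and mult: "\<And>a x. a \<in> I \<Longrightarrow> x \<in> carrier R \<Longrightarrow> x \<otimes> a \<in> I"
  shows "left_ideal I R"
proof -
  have "\<ominus> a \<in> I" if "a \<in> I" for a
  proof -
    \<comment> \<open>Since the ring is unital, negation is left multiplication by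
      \<open>\<ominus> \<one>\<close>, so absorption yields closure under additive inverses.\<close>
    have "\<ominus> a = \<ominus> \<one> \<otimes> a"
      using that assms(1) by (simp add: l_minus subsetD)
    then show ?thesis
      using mult[OF that, of "\<ominus> \<one>"] by simp
  qed
  then have "subgroup I (add_monoid R)"
    using assms by (intro add.subgroupI) (auto simp: a_inv_def)
  then show ?thesis
    using mult by (intro left_ideal.intro left_ideal_axioms.intro additive_subgroup.intro ring_axioms)
qed

context left_ideal
begin

text \<open>Right multiplication by \<open>r\<close> is an endomorphism of \<open>R\<close> as a
  left module, and \<open>I #> r\<close> is the image of \<open>I\<close> under it. This allows
  essentiality to be tested against \<open>Jr\<close>.\<close>

lemma r_coset_left_ideal:
  assumes r: "r \<in> carrier R"
  shows "left_ideal (I #> r) R"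
proof (rule left_idealI)
  show "I #> r \<subseteq> carrier R"
    using r a_subset by (auto simp: r_coset_def)
  show "\<zero> \<in> I #> r"
    unfolding r_coset_def using l_null[OF r, symmetric] zero_closed by (intro UN_I) auto
  show "a \<oplus> b \<in> I #> r" if ab: "a \<in> I #> r" "b \<in> I #> r" for a b
  proof -
    from ab obtain x y where "x \<in> I" "y \<in> I" "a = x \<otimes> r" "b = y \<otimes> r"
      by (auto simp: r_coset_def)
    moreover from this have "a \<oplus> b = (x \<oplus> y) \<otimes> r"
      using r by (simp add: l_distr)
    ultimately show ?thesis
      unfolding r_coset_def using a_closed by blast
  qed
  show "x \<otimes> a \<in> I #> r" if a: "a \<in> I #> r" and x: "x \<in> carrier R" for a x
  proof -
    from a obtain y where "y \<in> I" "a = y \<otimes> r"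
      by (auto simp: r_coset_def)
    moreover from this have "x \<otimes> a = (x \<otimes> y) \<otimes> r"
      using r x by (simp add: m_assoc)
    ultimately show ?thesis
      unfolding r_coset_def using x I_l_closed by blast
  qed
qed

text \<open>This is the colon ideal \<open>(I : r)\<close>, the preimage of \<open>I\<close> under
  the same endomorphism.\<close>

lemma left_ideal_colon:
  assumes r: "r \<in> carrier R"
  shows "left_ideal {x \<in> carrier R. x \<otimes> r \<in> I} R"
  using r by (intro left_idealI) (auto simp: l_distr m_assoc I_l_closed)

end

text \<open>Let \<open>J\<close> meet \<open>(I : r)\<close> only in zero. If \<open>jr\<close> lies
  in \<open>I\<close> with \<open>j\<close> in \<open>J\<close>, then \<open>j\<close> lies in both,
  so \<open>j\<close> is zero; hence \<open>Jr\<close> meets \<open>I\<close> trivially, and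
  \<open>Jr\<close> is zero because \<open>I\<close> is essential. But then \<open>r\<close>
  multiplies \<open>J\<close> into \<open>I\<close>, so \<open>J\<close> lies inside
  \<open>(I : r)\<close> and must be zero.\<close>

lemma essential_left_ideal_colon:
  fixes R (structure)
  assumes I: "essential_left_ideal I R" and r: "r \<in> carrier R"
  shows "essential_left_ideal {x \<in> carrier R. x \<otimes> r \<in> I} R"
    (is "essential_left_ideal ?L R")
proof -
  interpret I: left_ideal I R
    using I by (simp add: essential_left_ideal_def)
  have "J = {\<zero>}" if J: "left_ideal J R" and disj: "?L \<inter> J = {\<zero>}" for J
  proof -
    interpret J: left_ideal J R by (rule J)
    have "J #> r = {\<zero>}"
    proof (rule ccontr)
      assume "J #> r \<noteq> {\<zero>}"
      then have "I \<inter> (J #> r) \<noteq> {\<zero>}"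
        using I J.r_coset_left_ideal[OF r] by (simp add: essential_left_ideal_def)
      moreover have "I \<inter> (J #> r) \<subseteq> {\<zero>}"
      proof
        fix y assume "y \<in> I \<inter> (J #> r)"
        then obtain j where j: "j \<in> J" "y = j \<otimes> r" "j \<otimes> r \<in> I"
          by (auto simp: r_coset_def)
        then have "j \<in> ?L \<inter> J" by simp
        then show "y \<in> {\<zero>}" using disj j r by simp
      qed
      \<comment> \<open>Essentiality is phrased as inequality with \<open>{\<zero>}\<close>, so the
        inclusion above contradicts it only once the intersection is known to be nonempty.\<close>
      moreover have "\<zero> \<in> I \<inter> (J #> r)"
        using additive_subgroup.zero_closed[OF left_ideal.axioms(1)[OF J.r_coset_left_ideal[OF r]]]
        by simp
      ultimately show False by blast
    qed
    moreover have "x \<otimes> r \<in> J #> r" if "x \<in> J" for x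
      using that by (auto simp: r_coset_def)
    \<comment> \<open>Every \<open>x \<otimes> r\<close> with \<open>x\<close> in \<open>J\<close>
      is now zero, and zero belongs to \<open>I\<close>.\<close>
    ultimately have "J \<subseteq> ?L" by auto
    with disj show ?thesis by blast
  qed
  then show ?thesis
    using I.left_ideal_colon[OF r] unfolding essential_left_ideal_def by blast
qed

theorem proposition2p7:
  fixes R :: "('a, 'b) ring_scheme" and S :: "'a set"
  assumes "ring R"
    and "multiplicative_subset S R"
    and A: "\<And>s. s \<in> S \<Longrightarrow> essential_left_ideal (carrier R #>\<^bsub>R\<^esub> s) R"
    and B: "\<And>L. essential_left_ideal L R \<Longrightarrow> S \<inter> L \<noteq> {}"
  shows "left_Ore_set S R"
  unfolding left_Ore_set_def
proof (intro conjI ballI)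
  show "multiplicative_subset S R" by fact
next
  fix r s assume "r \<in> carrier R" "s \<in> S"
  \<comment> \<open>The witness \<open>t\<close> is a point of \<open>S\<close> in the essential
    left ideal \<open>(Rs : r)\<close>.\<close>
  then obtain t where "t \<in> S" "t \<otimes>\<^bsub>R\<^esub> r \<in> carrier R #>\<^bsub>R\<^esub> s"
    using B[OF essential_left_ideal_colon[OF A]] by blast
  then show "(S #>\<^bsub>R\<^esub> r) \<inter> (carrier R #>\<^bsub>R\<^esub> s) \<noteq> {}"
    by (auto simp: r_coset_def)
qed

end
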